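(* If a step set $X\subseteq\mathbb{Z}^2\setminus\{O\}$ does not satisfy the Line Condition (LC) but does have the Bounded Paths Property (BPP), then $X$ has the Finite Paths Property (FPP).
   Context: Write $O=(0,0)$. A step set is any (finite or infinite) subset $X$ of $\mathbb{Z}^2\setminus\{O\}$. $\mathcal{F}_X$ is the free monoid on $X$ (all finite words over $X$, including the empty word), with $\ell(w)$ the length of a word $w$; $\mathcal{A}_X$ is the additive submonoid of $\mathbb{Z}^2$ generated by $X$; and $\alpha_X:\mathcal{F}_X\to\mathcal{A}_X$ is given by $\alpha_X(A_1\cdots A_k)=A_1+\cdots+A_k$. For $A\in\mathbb{Z}^2$ let $\Pi_X(A)=\{w\in\mathcal{F}_X:\alpha_X(w)=A\}$ and $\pi_X(A)=|\Pi_X(A)|$. $X$ has the FPP if $\pi_X(A)<\infty$ for all $A\in\mathcal{A}_X$. $X$ has the BPP if for every $A\in\mathcal{A}_X$ the set $\{\ell(w):w\in\Pi_X(A)\}$ is finite. $X$ satisfies the LC if it is contained in an open half-plane of $\mathbb{R}^2$ bounded by a line through $O$. *)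

theory Defs
  imports "HOL-Analysis.Analysis"
begin

definition step_set :: "(int \<times> int) set \<Rightarrow> bool" where
  "step_set X \<longleftrightarrow> (0, 0) \<notin> X"

inductive_set gen_submonoid :: "(int \<times> int) set \<Rightarrow> (int \<times> int) set"
  for X :: "(int \<times> int) set" where
  zero: "0 \<in> gen_submonoid X"
| gen: "A \<in> X \<Longrightarrow> A \<in> gen_submonoid X"
| add: "A \<in> gen_submonoid X \<Longrightarrow> B \<in> gen_submonoid X \<Longrightarrow> A + B \<in> gen_submonoid X"

(* The free monoid on X is lists X, and the evaluation map alpha is sum_list. *)
definition paths :: "(int \<times> int) set \<Rightarrow> int \<times> int \<Rightarrow> (int \<times> int) list set" where
  "paths X A = {w \<in> lists X. sum_list w = A}"

definition FPP :: "(int \<times> int) set \<Rightarrow> bool" where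
  "FPP X \<longleftrightarrow> (\<forall>A \<in> gen_submonoid X. finite (paths X A))"

definition BPP :: "(int \<times> int) set \<Rightarrow> bool" where
  "BPP X \<longleftrightarrow> (\<forall>A \<in> gen_submonoid X. finite (length ` paths X A))"

definition to_plane :: "int \<times> int \<Rightarrow> real \<times> real" where
  "to_plane A = (real_of_int (fst A), real_of_int (snd A))"

(* The bounding line is the orthogonal complement of the normal vector n; replacing n by -n
   gives the opposite side, so every open half-plane bounded by a line through the origin
   arises. *)
definition open_half_plane :: "(real \<times> real) set \<Rightarrow> bool" where
  "open_half_plane H \<longleftrightarrow> (\<exists>n. n \<noteq> 0 \<and> H = {v. n \<bullet> v > 0})"

definition LC :: "(int \<times> int) set \<Rightarrow> bool" where
  "LC X \<longleftrightarrow> (\<exists>H. open_half_plane H \<and> to_plane ` X \<subseteq> H)"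

end

theory Submission
  imports Defs
begin

text \<open>
  Repeating a nonempty zero-sum word gives zero-sum words of unbounded length, so BPP rules out
  zero-sum words. Steps being lattice points, a convex combination of steps equal to \<open>O\<close> could be
  made integral; hence \<open>O\<close> is outside the convex hull of \<open>X\<close>, and \<open>X\<close> lies in a closed half-plane.
  Failure of LC puts some \<open>e \<in> X\<close> on the bounding line, which therefore has an integral normal:
  the height \<open>h x = \<plusminus> det2 e x\<close> is nonnegative on \<open>X\<close>. At each height, only finitely many steps have
  nonpositive inner product with \<open>e\<close>: otherwise, within one residue class, a fixed step would be
  the sum of another step and arbitrarily many copies of \<open>e\<close>. Now a path to \<open>A\<close> has bounded length
  and uses steps of height at most \<open>h A\<close>; their inner products with \<open>e\<close> are bounded below and,
  having a prescribed sum, also above.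
\<close>

section \<open>Coordinates relative to a step\<close>

definition det2 :: "int \<times> int \<Rightarrow> int \<times> int \<Rightarrow> int" where
  "det2 x y = fst x * snd y - snd x * fst y"

definition dot2 :: "int \<times> int \<Rightarrow> int \<times> int \<Rightarrow> int" where
  "dot2 x y = fst x * fst y + snd x * snd y"

lemma det2_sum_list: "det2 e (sum_list w) = (\<Sum>x\<leftarrow>w. det2 e x)"
  by (induction w) (auto simp: det2_def algebra_simps)

lemma dot2_sum_list: "dot2 e (sum_list w) = (\<Sum>x\<leftarrow>w. dot2 e x)"
  by (induction w) (auto simp: dot2_def algebra_simps)

lemma dot2_self_pos:
  assumes "e \<noteq> (0, 0)"
  shows "dot2 e e > 0"
proof -
  have "fst e \<noteq> 0 \<or> snd e \<noteq> 0"
    using assms by (metis prod.collapse)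
  then show ?thesis
    unfolding dot2_def by (metis sum_squares_gt_zero_iff)
qed

text \<open>Expansion of \<open>x\<close> in the orthogonal basis formed by \<open>e\<close> and its
  quarter turn \<open>(- snd e, fst e)\<close>, with the denominator \<open>dot2 e e\<close>
  cleared.\<close>

lemma dot2_self_mult:
  "dot2 e e * fst x = dot2 e x * fst e - det2 e x * snd e"
  "dot2 e e * snd x = dot2 e x * snd e + det2 e x * fst e"
  by (simp_all add: dot2_def det2_def algebra_simps)

lemma det2_dot2_inj:
  assumes "e \<noteq> (0, 0)" "det2 e x = det2 e y" "dot2 e x = dot2 e y"
  shows "x = y"
proof -
  have "dot2 e e * fst x = dot2 e e * fst y" "dot2 e e * snd x = dot2 e e * snd y"
    by (simp_all add: dot2_self_mult assms)
  then show ?thesis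
    using dot2_self_pos[OF assms(1)] by (auto intro: prod_eqI)
qed

section \<open>Zero-sum words and relations between steps\<close>

lemma sum_list_replicate_pair:
  "sum_list (replicate n x) = (int n * fst x, int n * snd (x :: int \<times> int))"
  by (induction n) (auto simp: algebra_simps prod_eq_iff)

lemma sum_list_concat_replicate_0:
  "sum_list w = 0 \<Longrightarrow> sum_list (concat (replicate k w)) = (0 :: 'a :: monoid_add)"
  by (induction k) auto

lemma BPP_zero_sum_free:
  assumes "BPP X" "w \<in> lists X" "sum_list w = 0"
  shows "w = []"
proof (rule ccontr)
  assume "w \<noteq> []"
  have "inj (\<lambda>k. length (concat (replicate k w)))"
    using \<open>w \<noteq> []\<close> by (auto simp: inj_def length_concat sum_list_replicate)
  then have "infinite (range (\<lambda>k. length (concat (replicate k w))))"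
    using finite_imageD infinite_UNIV_nat by blast
  moreover have "concat (replicate k w) \<in> paths X 0" for k
    unfolding paths_def
    using assms(2) sum_list_concat_replicate_0[OF assms(3), of k] by (auto simp: in_lists_conv_set)
  then have "range (\<lambda>k. length (concat (replicate k w))) \<subseteq> length ` paths X 0"
    by blast
  moreover have "finite (length ` paths X 0)"
    using assms(1) gen_submonoid.zero unfolding BPP_def by blast
  ultimately show False
    using finite_subset by blast
qed

text \<open>The coefficients count the copies of each step in a zero-sum word. The steps may
  coincide, so shorter relations are covered as well.\<close>

lemma BPP_no_relation:
  assumes "BPP X" "x \<in> X" "y \<in> X" "z \<in> X" "a \<ge> 0" "b \<ge> 0" "c \<ge> 0"
    and "a * fst x + b * fst y + c * fst z = 0" "a * snd x + b * snd y + c * snd z = 0"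
  shows "a = 0 \<and> b = 0 \<and> c = 0"
proof -
  let ?w = "replicate (nat a) x @ replicate (nat b) y @ replicate (nat c) z"
  have "?w \<in> lists X"
    using assms(2-4) by auto
  moreover have "sum_list ?w = 0"
    using assms by (simp add: sum_list_replicate_pair zero_prod_def)
  ultimately have "?w = []"
    by (rule BPP_zero_sum_free[OF assms(1)])
  then show ?thesis
    using assms(5-7) by simp
qed

lemma BPP_parallel:
  assumes "BPP X" "step_set X" "x \<in> X" "y \<in> X" "det2 x y = 0"
  shows "dot2 x y > 0"
proof (rule ccontr)
  assume *: "\<not> dot2 x y > 0"
  have pos: "dot2 x x > 0"
    using assms by (intro dot2_self_pos) (auto simp: step_set_def)
  \<comment> \<open>For parallel steps, \<open>dot2 x x\<close> copies of \<open>y\<close> cancel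
    against \<open>- dot2 x y\<close> copies of \<open>x\<close>; the last coefficient is
    padding.\<close>
  have "dot2 x x = 0 \<and> - dot2 x y = 0 \<and> (0::int) = 0"
    by (rule BPP_no_relation[OF assms(1) assms(4,3,3)])
      (use * pos assms(5) in \<open>auto simp: dot2_self_mult\<close>)
  then show False
    using pos by simp
qed

lemma BPP_no_real_relation:
  assumes "BPP X" "step_set X" and mem: "x \<in> X" "y \<in> X" "z \<in> X"
    and nonneg: "0 \<le> a" "0 \<le> b" "0 \<le> c" and ne: "a + b + c \<noteq> (0::real)"
    and rel: "a * of_int (fst x) + b * of_int (fst y) + c * of_int (fst z) = 0"
      "a * of_int (snd x) + b * of_int (snd y) + c * of_int (snd z) = 0"
  shows False
proof -
  text \<open>By Cramer, the real relation is proportional to the integral one with coefficients \<open>D1\<close>, \<open>D2\<close>, \<open>D3\<close>.\<close>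
  define D1 D2 D3 where D: "D1 = det2 y z" "D2 = det2 z x" "D3 = det2 x y"
  have p: "a * of_int D2 = b * of_int D1" "b * of_int D3 = c * of_int D2"
      "a * of_int D3 = c * of_int D1"
    using rel unfolding D det2_def by (simp; algebra)+
  have int_rel: "D1 * fst x + D2 * fst y + D3 * fst z = 0" "D1 * snd x + D2 * snd y + D3 * snd z = 0"
    unfolding D det2_def by (simp_all add: algebra_simps)
  have sign: "(0 \<le> D1 \<and> 0 \<le> D2 \<and> 0 \<le> D3) \<or> (D1 \<le> 0 \<and> D2 \<le> 0 \<and> D3 \<le> 0)"
  proof -
    have pos: "a + b + c > 0"
      using nonneg ne by linarith
    \<comment> \<open>Adding the proportionalities makes each determinant a nonnegative multiple of
      their sum, so all three share its sign.\<close>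
    have weights: "(a + b + c) * of_int D1 = a * of_int (D1 + D2 + D3)"
        "(a + b + c) * of_int D2 = b * of_int (D1 + D2 + D3)"
        "(a + b + c) * of_int D3 = c * of_int (D1 + D2 + D3)"
      using p by (simp_all add: algebra_simps)
    have "0 \<le> D" if "(a + b + c) * of_int D = k * of_int E" "k \<ge> 0" "0 \<le> E" for k and D E :: int
      using that pos by (metis mult_nonneg_nonneg of_int_0_le_iff zero_le_mult_iff not_less)
    moreover have "D \<le> 0" if "(a + b + c) * of_int D = k * of_int E" "k \<ge> 0" "E \<le> 0" for k and D E :: int
      using that pos by (metis mult_nonneg_nonpos of_int_le_0_iff mult_le_0_iff not_less)
    ultimately show ?thesis
      using weights nonneg linear[of 0 "D1 + D2 + D3"] by meson
  qed
  then have zero: "D1 = 0" "D2 = 0" "D3 = 0"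
    using BPP_no_relation[OF assms(1) mem, of D1 D2 D3]
      BPP_no_relation[OF assms(1) mem, of "- D1" "- D2" "- D3"] int_rel
    by (auto simp: algebra_simps)
  \<comment> \<open>What remains is the parallel case: pairing the relation with \<open>x\<close>
    gives nonnegative terms adding up to 0.\<close>
  then have "det2 x x = 0" "det2 x y = 0" "det2 x z = 0"
    unfolding D by (simp_all add: det2_def algebra_simps)
  then have pos: "dot2 x x > 0" "dot2 x y > 0" "dot2 x z > 0"
    using BPP_parallel[OF assms(1,2)] mem by blast+
  have "a * of_int (dot2 x x) + b * of_int (dot2 x y) + c * of_int (dot2 x z) = 0"
    using rel unfolding dot2_def by simp algebra
  moreover have "a * of_int (dot2 x x) \<ge> 0" "b * of_int (dot2 x y) \<ge> 0" "c * of_int (dot2 x z) \<ge> 0"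
    using pos nonneg by simp_all
  ultimately have "a * of_int (dot2 x x) = 0" "b * of_int (dot2 x y) = 0" "c * of_int (dot2 x z) = 0"
    by linarith+
  then show False
    using pos ne by simp
qed

section \<open>Separating the origin from the steps\<close>

lemma BPP_zero_notin_hull:
  assumes "BPP X" "step_set X"
  shows "0 \<notin> convex hull (to_plane ` X)"
proof
  assume "0 \<in> convex hull (to_plane ` X)"
  then obtain S where S: "finite S" "S \<subseteq> to_plane ` X" "card S \<le> 3" "0 \<in> convex hull S"
    by (subst (asm) caratheodory) auto
  have "S \<noteq> {}"
    using S(4) by auto
  \<comment> \<open>Caratheodory's bound in the plane is three points; smaller sets are padded by
    repetition.\<close>
  have "\<exists>u v w. S = {u, v, w}"
  proof -
    have "card S = 1 \<or> card S = 2 \<or> card S = 3"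
      using S(1,3) \<open>S \<noteq> {}\<close> card_gt_0_iff[of S] by linarith
    then show ?thesis
      by (metis card_1_singletonE card_2_iff card_3_iff insert_absorb2)
  qed
  then obtain u v w where uvw: "S = {u, v, w}"
    by blast
  then obtain a b c where abc: "0 \<le> a" "0 \<le> b" "0 \<le> c" "a + b + c = 1"
      "a *\<^sub>R u + b *\<^sub>R v + c *\<^sub>R w = 0"
    using S(4) unfolding uvw convex_hull_3 mem_Collect_eq by metis
  obtain x y z where "x \<in> X" "y \<in> X" "z \<in> X" "u = to_plane x" "v = to_plane y" "w = to_plane z"
    using S(2) uvw by auto
  then show False
    using abc BPP_no_real_relation[OF assms, of x y z a b c]
    by (auto simp: to_plane_def zero_prod_def)
qed

lemma BPP_supporting_step:
  assumes "BPP X" "step_set X" "\<not> LC X"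
  obtains e s where "e \<in> X" "\<And>x. x \<in> X \<Longrightarrow> det2 e x * s \<ge> 0" "s \<noteq> 0"
proof -
  obtain n where n: "n \<noteq> 0" "\<And>v. v \<in> convex hull (to_plane ` X) \<Longrightarrow> 0 \<le> n \<bullet> v"
    using separating_hyperplane_set_0[OF convex_convex_hull BPP_zero_notin_hull[OF assms(1,2)]]
    by blast
  then have n_ge: "0 \<le> n \<bullet> to_plane x" if "x \<in> X" for x
    using that by (simp add: hull_inc)
  have "\<not> to_plane ` X \<subseteq> {v. n \<bullet> v > 0}"
    using assms(3) n(1) unfolding LC_def open_half_plane_def by blast
  then obtain e where "e \<in> X" "\<not> n \<bullet> to_plane e > 0"
    by blast
  then have e: "e \<in> X" "n \<bullet> to_plane e = 0"
    using n_ge[of e] by simp_all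
  have epos: "dot2 e e > 0"
    using e(1) assms(2) by (intro dot2_self_pos) (auto simp: step_set_def)
  \<comment> \<open>The pairing of \<open>n\<close> with the quarter turn of \<open>e\<close>. As
    \<open>n\<close> is orthogonal to \<open>e\<close>, it is that quarter turn scaled by
    \<open>t / dot2 e e\<close>, so only the sign of \<open>t\<close> matters.\<close>
  define t where "t = snd n * of_int (fst e) - fst n * of_int (snd e)"
  have n_eq: "of_int (dot2 e e) * (n \<bullet> to_plane x) = t * of_int (det2 e x)" for x
    using e(2) unfolding t_def dot2_def det2_def inner_prod_def to_plane_def
    by simp algebra
  have "t \<noteq> 0"
  proof
    assume "t = 0"
    then have "of_int (dot2 e e) * fst n = 0" "of_int (dot2 e e) * snd n = 0"
      using e(2) unfolding t_def dot2_def inner_prod_def to_plane_def inner_real_def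
        fst_conv snd_conv of_int_add of_int_mult by (-, algebra+)
    then show False
      using epos n(1) by (simp add: prod_eq_iff)
  qed
  show ?thesis
  proof
    show "e \<in> X" by (fact e(1))
    show "(if t > 0 then 1 else - 1) \<noteq> (0::int)" by simp
    fix x assume "x \<in> X"
    then have "0 \<le> t * of_int (det2 e x)"
      using n_eq[of x] n_ge[of x] epos by (metis mult_nonneg_nonneg of_int_0_le_iff less_imp_le)
    then show "det2 e x * (if t > 0 then 1 else - 1) \<ge> 0"
      using \<open>t \<noteq> 0\<close> by (auto simp: zero_le_mult_iff)
  qed
qed

section \<open>Finiteness on each level\<close>

lemma BPP_finite_nonpos_on_level:
  assumes "BPP X" "step_set X" "e \<in> X"
  shows "finite {x \<in> X. det2 e x = k \<and> dot2 e x \<le> 0}" (is "finite ?S")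
proof (rule ccontr)
  assume "infinite ?S"
  define d where "d = dot2 e e"
  have e0: "e \<noteq> (0, 0)"
    using assms(2,3) by (auto simp: step_set_def)
  have d: "d > 0"
    unfolding d_def using e0 by (rule dot2_self_pos)
  \<comment> \<open>On one level, steps whose inner products with \<open>e\<close> agree modulo
    \<open>d\<close> differ by an integer multiple of \<open>e\<close>.\<close>
  have "(\<lambda>x. dot2 e x mod d) ` ?S \<subseteq> {0..<d}"
    using d by auto
  then have "finite ((\<lambda>x. dot2 e x mod d) ` ?S)"
    using finite_subset by blast
  then obtain a where "infinite {x \<in> ?S. dot2 e x mod d = dot2 e a mod d}"
    using pigeonhole_infinite[OF \<open>infinite ?S\<close>] by blast
  moreover define F where "F = {x \<in> ?S. dot2 e x mod d = dot2 e a mod d}"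
  ultimately have F: "infinite F" "F \<subseteq> ?S"
      "\<And>x y. x \<in> F \<Longrightarrow> y \<in> F \<Longrightarrow> dot2 e x mod d = dot2 e y mod d"
    by auto
  obtain x0 where "x0 \<in> F"
    using F(1) infinite_imp_nonempty by blast
  \<comment> \<open>Inner products in \<open>F\<close> are nonpositive, so \<open>nat\<close> loses
    nothing and \<open>y\<close> has the largest one; every other step of \<open>F\<close> reaches
    \<open>y\<close> by adding copies of \<open>e\<close>.\<close>
  then obtain y where y: "y \<in> F" "\<And>x. x \<in> F \<Longrightarrow> nat (- dot2 e y) \<le> nat (- dot2 e x)"
    using ex_has_least_nat[of "\<lambda>x. x \<in> F" x0 "\<lambda>x. nat (- dot2 e x)"] by blast
  have le: "dot2 e x \<le> dot2 e y" if "x \<in> F" for x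
    using y(2)[OF that] that y(1) F(2) by force
  define m where "m x = (dot2 e y - dot2 e x) div d" for x
  have m: "d * m x = dot2 e y - dot2 e x" "m x \<ge> 0" if "x \<in> F" for x
    using F(3)[OF that y(1)] le[OF that] d unfolding m_def
    by (metis dvd_mult_div_cancel mod_eq_dvd_iff, simp add: pos_imp_zdiv_nonneg_iff)
  have path: "x # replicate (nat (m x)) e \<in> paths X y" if "x \<in> F" for x
  proof -
    have "det2 e x = det2 e y"
      using that y(1) F(2) by auto
    then have "d * fst y = d * (fst x + m x * fst e)" "d * snd y = d * (snd x + m x * snd e)"
      using dot2_self_mult[of e x, folded d_def] dot2_self_mult[of e y, folded d_def] m(1)[OF that]
      by (simp_all add: distrib_left left_diff_distrib flip: mult.assoc)
    then have "sum_list (x # replicate (nat (m x)) e) = y"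
      using d m(2)[OF that] by (simp add: sum_list_replicate_pair prod_eq_iff)
    then show ?thesis
      using that F(2) assms(3) by (auto simp: paths_def)
  qed
  have "inj_on (\<lambda>x. length (x # replicate (nat (m x)) e)) F"
  proof (rule inj_onI)
    fix x x' assume xx': "x \<in> F" "x' \<in> F"
      "length (x # replicate (nat (m x)) e) = length (x' # replicate (nat (m x')) e)"
    then have "m x = m x'"
      using m(2) by (metis eq_nat_nat_iff length_Cons length_replicate nat.inject)
    then have "dot2 e x = dot2 e x'"
      using m(1)[OF xx'(1)] m(1)[OF xx'(2)] by simp
    moreover have "det2 e x = det2 e x'"
      using xx'(1,2) F(2) by auto
    ultimately show "x = x'"
      using det2_dot2_inj[OF e0] by blast
  qed
  then have "infinite ((\<lambda>x. length (x # replicate (nat (m x)) e)) ` F)"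
    using F(1) finite_imageD by blast
  moreover have "(\<lambda>x. length (x # replicate (nat (m x)) e)) ` F \<subseteq> length ` paths X y"
    using path by blast
  moreover have "finite (length ` paths X y)"
    using assms(1) y(1) F(2) gen_submonoid.gen unfolding BPP_def by blast
  ultimately show False
    using finite_subset by blast
qed

section \<open>Bounding the steps of a path\<close>

lemma sum_list_lower_bound:
  fixes f :: "'a \<Rightarrow> int"
  assumes "\<And>x. x \<in> set w \<Longrightarrow> f x \<ge> - C"
  shows "(\<Sum>x\<leftarrow>w. f x) \<ge> - (C * int (length w))"
  using assms by (induction w) (auto simp: algebra_simps, force)

text \<open>Every other entry contributes at least \<open>- C\<close>; counting \<open>x\<close> too
  only weakens the bound, as \<open>C\<close> is nonnegative.\<close>

lemma member_le_sum_list_lower_bound: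
  fixes f :: "'a \<Rightarrow> int"
  assumes "x \<in> set w" "C \<ge> 0" "\<And>x. x \<in> set w \<Longrightarrow> f x \<ge> - C"
  shows "f x \<le> (\<Sum>x\<leftarrow>w. f x) + C * int (length w)"
proof -
  obtain u v where w: "w = u @ x # v"
    using assms(1) split_list by metis
  have "(\<Sum>x\<leftarrow>u. f x) \<ge> - (C * int (length u))" "(\<Sum>x\<leftarrow>v. f x) \<ge> - (C * int (length v))"
    using assms(3) w by (auto intro!: sum_list_lower_bound)
  then show ?thesis
    using assms(2) by (simp add: w algebra_simps)
qed

theorem proposition2p43:
  fixes X :: "(int \<times> int) set"
  assumes "step_set X"
    and "\<not> LC X"
    and "BPP X"
  shows "FPP X"
  unfolding FPP_def
proof
  fix A assume A: "A \<in> gen_submonoid X"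
  obtain e s where e: "e \<in> X" and s: "\<And>x. x \<in> X \<Longrightarrow> det2 e x * s \<ge> 0" "s \<noteq> 0"
    using BPP_supporting_step[OF assms(3,1,2)] by blast
  have e0: "e \<noteq> (0, 0)"
    using e assms(1) by (auto simp: step_set_def)
  define h where "h x = det2 e x * s" for x
  define K where "K = h A"
  obtain N where N: "\<And>w. w \<in> paths X A \<Longrightarrow> length w \<le> N"
    using assms(3) A unfolding BPP_def by (meson finite_nat_set_iff_bounded_le imageI)
  have h_le: "0 \<le> h x \<and> h x \<le> K" if "w \<in> paths X A" "x \<in> set w" for w x
  proof -
    have X: "set w \<subseteq> X" and sum: "sum_list w = A"
      using that(1) by (auto simp: paths_def)
    \<comment> \<open>Heights are nonnegative, so the lower bound is taken with
      \<open>C = 0\<close>.\<close>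
    have "h x \<le> (\<Sum>x\<leftarrow>w. h x) + 0 * int (length w)"
      by (rule member_le_sum_list_lower_bound) (use that(2) X s in \<open>auto simp: h_def\<close>)
    moreover have "(\<Sum>x\<leftarrow>w. h x) = K"
      unfolding K_def h_def sum[symmetric] det2_sum_list by (simp add: sum_list_mult_const)
    moreover have "0 \<le> h x"
      using that(2) X s(1) unfolding h_def by blast
    ultimately show ?thesis
      by simp
  qed
  define T where "T = {x \<in> X. 0 \<le> h x \<and> h x \<le> K \<and> dot2 e x \<le> 0}"
  \<comment> \<open>Dividing by the nonzero \<open>s\<close> recovers the level from the height, so
    finitely many levels occur.\<close>
  have "T \<subseteq> (\<Union>k\<in>(\<lambda>i. i div s) ` {0..K}. {x \<in> X. det2 e x = k \<and> dot2 e x \<le> 0})"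
    using s(2) unfolding T_def h_def by force
  moreover have "finite (\<Union>k\<in>(\<lambda>i. i div s) ` {0..K}. {x \<in> X. det2 e x = k \<and> dot2 e x \<le> 0})"
    using BPP_finite_nonpos_on_level[OF assms(3,1) e] by blast
  ultimately have "finite T"
    by (rule finite_subset)
  then obtain c where c: "\<And>x. x \<in> T \<Longrightarrow> nat (- dot2 e x) \<le> c"
    using finite_nat_set_iff_bounded_le[of "(\<lambda>x. nat (- dot2 e x)) ` T"] by blast
  define C where "C = int c"
  have "C \<ge> 0"
    by (simp add: C_def)
  have T_ge: "dot2 e x \<ge> - C" if "x \<in> T" for x
    using c[OF that] unfolding C_def by linarith
  \<comment> \<open>Using \<open>N\<close> in place of the length of a path makes this upper bound
    the same for all paths to \<open>A\<close>.\<close>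
  define M where "M = dot2 e A + C * int N"
  define B where "B = {x. h x \<in> {0..K} \<and> dot2 e x \<in> {- C..M}}"
  have "inj_on (\<lambda>x. (h x, dot2 e x)) B"
    using s(2) by (intro inj_onI det2_dot2_inj[OF e0]) (simp_all add: h_def)
  moreover have "finite ((\<lambda>x. (h x, dot2 e x)) ` B)"
    by (rule finite_subset[of _ "{0..K} \<times> {- C..M}"]) (auto simp: B_def)
  ultimately have "finite B"
    using finite_imageD by blast
  have "set w \<subseteq> B" if w: "w \<in> paths X A" for w
  proof
    fix x assume x: "x \<in> set w"
    have lower: "dot2 e z \<ge> - C" if "z \<in> set w" for z
    proof (cases "dot2 e z \<le> 0")
      case True
      then have "z \<in> T"
        using h_le[OF w that] w that by (auto simp: T_def paths_def)
      then show ?thesis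
        by (rule T_ge)
    qed (use \<open>C \<ge> 0\<close> in simp)
    have "dot2 e x \<le> (\<Sum>x\<leftarrow>w. dot2 e x) + C * int (length w)"
      by (rule member_le_sum_list_lower_bound[OF x \<open>C \<ge> 0\<close> lower])
    also have "(\<Sum>x\<leftarrow>w. dot2 e x) = dot2 e A"
      using w by (simp add: paths_def flip: dot2_sum_list)
    also have "dot2 e A + C * int (length w) \<le> M"
      using N[OF w] \<open>C \<ge> 0\<close> by (simp add: M_def mult_left_mono)
    finally show "x \<in> B"
      using lower[OF x] h_le[OF w x] by (auto simp: B_def)
  qed
  then have "paths X A \<subseteq> {w. set w \<subseteq> B \<and> length w \<le> N}"
    using N by blast
  then show "finite (paths X A)"
    using finite_lists_length_le[OF \<open>finite B\<close>] finite_subset by blast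
qed

end
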